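(* Let $A, B, C, D, E, G$ be $n\times n$ complex matrices, and let $X, Y$ be diagonalizable $n \times n$ complex matrices with common eigenvectors, written as $X = T F_1 T^{-1}$ and $Y = T F_2 T^{-1}$, where $T$ is invertible and $F_1, F_2$ are diagonal matrices containing the eigenvalues of $X$ and $Y$ respectively. If $$A X^2 + B Y^2 + CXY + DX + EY + G = 0,$$ then $T$ satisfies the homogeneous system of linear equations $$A T F_1^2 + B T F_2^2 + C T F_1 F_2 + D T F_1 + E T F_2 + G T = 0 .$$ *)

theory Defs
  imports Complex_Main "Jordan_Normal_Form.Matrix"
begin

end

theory Submission
  imports Defs
begin

text \<open>
  Cancelling the inverse in X = T F1 T\<inverse> leaves the intertwining relation X T = T F1, and
  likewise Y T = T F2.  Multiplying the matrix equation on the right by T therefore lets T travel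
  leftwards through every factor X and Y, which it turns into F1 and F2: the degree-two words
  satisfy X (X T) = (X T) F1 = T F1 F1 (\<open>intertwine_mult\<close>), and the right-hand side stays 0.
  The result is linear in T because no inverse of T survives the rewriting.
\<close>

text \<open>Similarity by an invertible matrix is used only in this form, from which the inverse has
  disappeared.\<close>

lemma similar_imp_intertwine:
  fixes T :: "'a::comm_ring_1 mat"
  assumes "T \<in> carrier_mat n n" "S \<in> carrier_mat n n" "F \<in> carrier_mat n n"
    and "inverts_mat S T" and "X = T * F * S"
  shows "X * T = T * F"
proof -
  have "X * T = T * F * (S * T)"
    using assms by (simp add: assoc_mult_mat[of _ n n _ n _ n])
  also have "S * T = 1\<^sub>m n"
    using assms by (simp add: inverts_mat_def)
  finally show ?thesis
    using assms by simp
qed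

text \<open>Intertwining is multiplicative: X (Y T) = X (T H) = (X T) H = T F H.\<close>

lemma intertwine_mult:
  fixes T :: "'a::comm_ring_1 mat"
  assumes "T \<in> carrier_mat n n" "X \<in> carrier_mat n n" "Y \<in> carrier_mat n n"
    "F \<in> carrier_mat n n" "H \<in> carrier_mat n n"
    and "X * T = T * F" and "Y * T = T * H"
  shows "(X * Y) * T = T * (F * H)"
proof -
  note assoc = assoc_mult_mat[of _ n n _ n _ n]
  have "(X * Y) * T = X * (T * H)"
    using assms by (simp add: assoc)
  also have "\<dots> = (X * T) * H"
    using assms(1-5) by (simp add: assoc)
  also have "\<dots> = T * (F * H)"
    unfolding assms(6) using assms(1-5) by (simp add: assoc)
  finally show ?thesis .
qed

lemma pow_mat_2:
  fixes A :: "'a::comm_ring_1 mat"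
  assumes "A \<in> carrier_mat n n"
  shows "A ^\<^sub>m 2 = A * A"
  using assms by (simp add: numeral_2_eq_2)

theorem mainTheorem4:
  fixes n :: nat
    and A B C D E G X Y T T_inv F1 F2 :: "complex mat"
  assumes "A \<in> carrier_mat n n" and "B \<in> carrier_mat n n" and "C \<in> carrier_mat n n"
    and "D \<in> carrier_mat n n" and "E \<in> carrier_mat n n" and "G \<in> carrier_mat n n"
    and "X \<in> carrier_mat n n" and "Y \<in> carrier_mat n n"
    and "T \<in> carrier_mat n n" and "T_inv \<in> carrier_mat n n"
    and "inverts_mat T T_inv" and "inverts_mat T_inv T"
    and "F1 \<in> carrier_mat n n" and "diagonal_mat F1"
    and "F2 \<in> carrier_mat n n" and "diagonal_mat F2"
    and "X = T * F1 * T_inv"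
    and "Y = T * F2 * T_inv"
    and "A * X ^\<^sub>m 2 + B * Y ^\<^sub>m 2 + C * X * Y + D * X + E * Y + G = 0\<^sub>m n n"
  shows "A * T * F1 ^\<^sub>m 2 + B * T * F2 ^\<^sub>m 2 + C * T * F1 * F2 + D * T * F1 + E * T * F2 + G * T
    = 0\<^sub>m n n"
proof -
  note carr = assms(1-10) assms(13) assms(15)
  note assoc = assoc_mult_mat[of _ n n _ n _ n]
  have XT: "X * T = T * F1" and YT: "Y * T = T * F2"
    using similar_imp_intertwine[OF _ _ _ \<open>inverts_mat T_inv T\<close>] carr
      \<open>X = T * F1 * T_inv\<close> \<open>Y = T * F2 * T_inv\<close> by simp_all
  have XXT: "(X * X) * T = T * (F1 * F1)" and YYT: "(Y * Y) * T = T * (F2 * F2)"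
    and XYT: "(X * Y) * T = T * (F1 * F2)"
    by (rule intertwine_mult[where n = n]; fact carr XT YT)+
  have "A * T * F1 ^\<^sub>m 2 + B * T * F2 ^\<^sub>m 2 + C * T * F1 * F2 + D * T * F1 + E * T * F2 + G * T
      = A * (T * (F1 * F1)) + B * (T * (F2 * F2)) + C * (T * (F1 * F2))
        + D * (T * F1) + E * (T * F2) + G * T"
    using carr by (simp add: pow_mat_2 assoc)
  also have "\<dots> = A * (X * X * T) + B * (Y * Y * T) + C * (X * Y * T)
        + D * (X * T) + E * (Y * T) + G * T"
    by (simp only: XT YT XXT YYT XYT)
  also have "\<dots> = (A * X ^\<^sub>m 2 + B * Y ^\<^sub>m 2 + C * X * Y + D * X + E * Y + G) * T"
    using carr by (simp add: pow_mat_2 assoc add_mult_distrib_mat[of _ n n _ _ n])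
  also have "\<dots> = 0\<^sub>m n n"
    using assms(19) \<open>T \<in> carrier_mat n n\<close> by simp
  finally show ?thesis .
qed

end
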